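(* Let $A\in\mathbb{R}^{n\times n}$ be invertible, let $U,V\in\mathbb{R}^{n\times k}$ have full column rank, assume $I+V^TA^{-1}U$ is invertible, and let $B=A+UV^T$. Let $\widetilde{A}^{-1}\in\mathbb{R}^{n\times n}$ and $Z^{-1}\in\mathbb{R}^{k\times k}$ be approximate inverses with errors $\epsilon_1=\|\widetilde{A}^{-1}-A^{-1}\|_2$ and $\epsilon_2=\|Z^{-1}-(I+V^T\widetilde{A}^{-1}U)^{-1}\|_2$, where $I+V^T\widetilde{A}^{-1}U$ is invertible, and let $\lambda=\|U\|_2\|V\|_2$. Let $\alpha$ satisfy $\|(I+V^TA^{-1}U)^{-1}\|_2\le\alpha$. Assume that $\epsilon_1=\epsilon_2=\epsilon\le1$, $\sigma_{\min}(A)\le1$, $\epsilon_1<\frac{1}{2\lambda\alpha}$, and $\alpha\ge\max(\lambda^{-1},1)$. Then $$\left\|B^{-1}-\left(\widetilde{A}^{-1}-\widetilde{A}^{-1}UZ^{-1}V^T\widetilde{A}^{-1}\right)\right\|_2\le 16\,\epsilon\,\lambda^2\|A^{-1}\|_2^2\,\alpha^2.$$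
   Context: $\|\cdot\|_2$ is the spectral norm, $\sigma_{\min}(A)$ is the smallest singular value of $A$, and $I$ is the identity matrix of appropriate size. $\widetilde{A}^{-1}$ is a single symbol for a given $n\times n$ matrix (the computed approximation of $A^{-1}$), and $Z^{-1}$ is a single symbol for a given $k\times k$ matrix (the computed approximation of $(I+V^T\widetilde{A}^{-1}U)^{-1}$). *)

theory Defs
  imports "HOL-Analysis.Analysis"
begin

abbreviation spectral_norm :: "real^'n^'m \<Rightarrow> real" where
  "spectral_norm A \<equiv> onorm ((*v) A)"

definition eigenvalues :: "real^'n^'n \<Rightarrow> real set" where
  "eigenvalues M = {\<mu>. \<exists>v. v \<noteq> 0 \<and> M *v v = \<mu> *\<^sub>R v}"

text \<open>
  Singular values are used for square matrices only, so every eigenvalue of \<open>A\<^sup>T A\<close>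
  contributes one; this would be wrong for a matrix with more columns than rows.
  The eigenvalues of \<open>A\<^sup>T A\<close> are all real and nonnegative, and there are finitely many
  (and at least one), so the minimum below is attained.
\<close>

definition singular_values :: "real^'n^'n \<Rightarrow> real set" where
  "singular_values A = sqrt ` eigenvalues (transpose A ** A)"

definition sigma_min :: "real^'n^'n \<Rightarrow> real" where
  "sigma_min A = Min (singular_values A)"

end

(*
  By the Woodbury identity the inverse of B is X - X U W V^T X, where X is the inverse of A and
  W that of the capacitance matrix I + V^T X U. Replacing X by At and W by Z one factor at a
  time, the error becomes a sum of four terms, each with exactly one small factor: three times
  At - X, once Z - W. The hypothesis on eps_1 keeps the perturbed capacitance matrix uniformly
  invertible, with inverse of norm at most 2 alpha, which bounds Z - W; and sigma_min A <= 1 gives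
  ||X|| >= 1, so that all four terms are dominated by multiples of lambda^2 ||X||^2 alpha^2.
*)
theory Submission
  imports Defs
begin

section \<open>Matrix algebra and inverses\<close>

lemma matrix_add_rdistrib:
  fixes A B :: "real^'n^'m" and C :: "real^'p^'n"
  shows "(A + B) ** C = A ** C + B ** C"
  by (simp add: matrix_matrix_mult_def vec_eq_iff algebra_simps sum.distrib)

lemma matrix_sub_ldistrib:
  fixes A :: "real^'n^'m" and B C :: "real^'p^'n"
  shows "A ** (B - C) = A ** B - A ** C"
  by (simp add: matrix_matrix_mult_def vec_eq_iff algebra_simps sum_subtractf)

lemma matrix_sub_rdistrib:
  fixes A B :: "real^'n^'m" and C :: "real^'p^'n"
  shows "(A - B) ** C = A ** C - B ** C"
  by (simp add: matrix_matrix_mult_def vec_eq_iff algebra_simps sum_subtractf)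

lemma matrix_inv_mult:
  fixes A :: "real^'n^'n"
  assumes "invertible A"
  shows "A ** matrix_inv A = mat 1" "matrix_inv A ** A = mat 1"
proof -
  have "A ** matrix_inv A = mat 1 \<and> matrix_inv A ** A = mat 1"
    using assms unfolding invertible_def matrix_inv_def by (rule someI_ex)
  then show "A ** matrix_inv A = mat 1" "matrix_inv A ** A = mat 1"
    by auto
qed

text \<open>For square matrices a right inverse is already two-sided, so a single product identifies
  the inverse.\<close>

lemma matrix_inv_eqI:
  fixes A M :: "real^'n^'n"
  assumes "A ** M = mat 1"
  shows "matrix_inv A = M"
proof -
  have "invertible A"
    using assms matrix_left_right_inverse unfolding invertible_def by blast
  then have "matrix_inv A = matrix_inv A ** (A ** M)"
    by (simp add: assms)
  also have "\<dots> = M"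
    by (simp add: matrix_mul_assoc matrix_inv_mult \<open>invertible A\<close>)
  finally show ?thesis .
qed

section \<open>Norm estimates for the spectral norm\<close>

lemma spectral_norm_nonneg: "0 \<le> spectral_norm A"
  for A :: "real^'n^'m"
  by (simp add: onorm_pos_le)

lemma norm_matrix_vector_le: "norm (A *v x) \<le> spectral_norm A * norm x"
  for A :: "real^'n^'m"
  by (simp add: onorm)

lemma spectral_norm_mult_le: "spectral_norm (A ** B) \<le> spectral_norm A * spectral_norm B"
  for A :: "real^'n^'m" and B :: "real^'p^'n"
  using onorm_compose[of "(*v) A" "(*v) B"]
  by (simp add: o_def matrix_vector_mul_assoc)

lemma spectral_norm_add_le: "spectral_norm (A + B) \<le> spectral_norm A + spectral_norm B"
  for A B :: "real^'n^'m"
  using onorm_triangle[of "(*v) A" "(*v) B"]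
  by (simp flip: matrix_vector_mult_add_rdistrib)

lemma spectral_norm_minus_commute: "spectral_norm (A - B) = spectral_norm (B - A)"
  for A B :: "real^'n^'m"
  proof -
  have "(\<lambda>x. - ((A - B) *v x)) = (*v) (B - A)"
    by (simp add: fun_eq_iff matrix_vector_mult_diff_rdistrib)
  then show ?thesis using onorm_neg[of "(*v) (A - B)"] by simp
qed

lemma spectral_norm_diff_le: "spectral_norm (A - B) \<le> spectral_norm A + spectral_norm B"
  for A B :: "real^'n^'m"
  using spectral_norm_add_le[of A "0 - B"] spectral_norm_minus_commute[of 0 B] by simp

lemma inner_matrix_transpose: "(A *v x) \<bullet> y = x \<bullet> (transpose A *v y)"
  for A :: "real^'n^'m"
  using dot_lmul_matrix[of y A x] by (simp add: inner_commute)

text \<open>With x = A^T y, |x|^2 = <A x, y> is at most ||A|| |x| |y|; cancelling one factor |x|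
  gives the bound.\<close>

lemma spectral_norm_transpose_le: "spectral_norm (transpose A) \<le> spectral_norm A"
  for A :: "real^'n^'m"
proof (rule onorm_le)
  fix y
  let ?x = "transpose A *v y"
  have "norm ?x * norm ?x = (A *v ?x) \<bullet> y"
    by (simp add: inner_matrix_transpose norm_eq_sqrt_inner)
  also have "\<dots> \<le> norm (A *v ?x) * norm y"
    by (rule norm_cauchy_schwarz)
  also have "\<dots> \<le> spectral_norm A * norm ?x * norm y"
    by (simp add: mult_right_mono norm_matrix_vector_le)
  finally have "norm ?x * norm ?x \<le> (spectral_norm A * norm y) * norm ?x"
    by (simp add: mult_ac)
  then show "norm ?x \<le> spectral_norm A * norm y"
    using spectral_norm_nonneg[of A] by (cases "norm ?x = 0") (auto simp: mult_le_cancel_right)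
qed

section \<open>Spectrum of symmetric matrices and the smallest singular value\<close>

text \<open>Eigenvectors of distinct eigenvalues are orthogonal, so choosing one per eigenvalue
  yields an independent set, which is finite in finite dimension.\<close>

lemma finite_eigenvalues_symmetric:
  fixes M :: "real^'n^'n"
  assumes sym: "transpose M = M"
  shows "finite (eigenvalues M)"
proof -
  define v where "v \<mu> = (SOME v. v \<noteq> 0 \<and> M *v v = \<mu> *\<^sub>R v)" for \<mu>
  have v: "v \<mu> \<noteq> 0 \<and> M *v v \<mu> = \<mu> *\<^sub>R v \<mu>" if "\<mu> \<in> eigenvalues M" for \<mu>
    using that someI_ex[of "\<lambda>v. v \<noteq> 0 \<and> M *v v = \<mu> *\<^sub>R v"]
    by (auto simp: eigenvalues_def v_def)
  have orth: "v \<mu> \<bullet> v \<nu> = 0"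
    if "\<mu> \<in> eigenvalues M" "\<nu> \<in> eigenvalues M" "\<mu> \<noteq> \<nu>" for \<mu> \<nu>
  proof -
    have "\<mu> * (v \<mu> \<bullet> v \<nu>) = \<nu> * (v \<mu> \<bullet> v \<nu>)"
      using inner_matrix_transpose[of M "v \<mu>" "v \<nu>"] v that by (simp add: sym)
    then show ?thesis using that by simp
  qed
  \<comment> \<open>A vector chosen for two distinct eigenvalues would be orthogonal to itself,
    hence zero.\<close>
  have inj: "inj_on v (eigenvalues M)"
    using orth v by (metis inj_onI inner_eq_zero_iff)
  have "pairwise orthogonal (v ` eigenvalues M)"
    using orth by (auto simp: pairwise_def orthogonal_def)
  then have "independent (v ` eigenvalues M)"
    using v by (intro pairwise_orthogonal_independent) auto
  then have "finite (v ` eigenvalues M)"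
    by (rule independent_imp_finite)
  then show ?thesis using inj by (rule finite_imageD)
qed

text \<open>If \<open>N *v v\<close> were nonzero, a small step from \<open>v\<close> against it
  would lower the quadratic form to first order, making it negative.\<close>

lemma psd_isotropic_imp_kernel:
  fixes N :: "real^'n^'n"
  assumes sym: "transpose N = N"
    and psd: "\<And>x. 0 \<le> x \<bullet> (N *v x)"
    and "v \<bullet> (N *v v) = 0"
  shows "N *v v = 0"
proof (rule ccontr)
  let ?w = "N *v v"
  assume "?w \<noteq> 0"
  then have pos: "?w \<bullet> ?w > 0" by simp
  define q where "q = ?w \<bullet> (N *v ?w)"
  \<comment> \<open>The form at \<open>v - t *\<^sub>R ?w\<close> equals t (t q - 2 |w|^2), which is
    negative for this \<open>t\<close>; the added 1 covers q = 0.\<close>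
  define t where "t = (?w \<bullet> ?w) / (q + 1)"
  have q: "q \<ge> 0" using psd by (simp add: q_def)
  have "v \<bullet> (N *v ?w) = ?w \<bullet> ?w"
    using inner_matrix_transpose[of N v ?w] by (simp add: sym)
  moreover have "0 \<le> (v - t *\<^sub>R ?w) \<bullet> (N *v (v - t *\<^sub>R ?w))"
    by (rule psd)
  ultimately have "0 \<le> t * (t * q - 2 * (?w \<bullet> ?w))"
    using assms(3)
    by (simp add: matrix_vector_mult_diff_distrib matrix_vector_mult_scaleR inner_diff_left
        inner_diff_right q_def algebra_simps)
  moreover have "t > 0" using pos q by (simp add: t_def)
  ultimately have "2 * (?w \<bullet> ?w) \<le> t * q"
    by (simp add: zero_le_mult_iff)
  also have "\<dots> \<le> t * (q + 1)" using \<open>t > 0\<close> by simp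
  also have "\<dots> = ?w \<bullet> ?w" using q by (simp add: t_def)
  finally show False using pos by simp
qed

text \<open>The minimum of the Rayleigh quotient is an eigenvalue.\<close>

lemma eigenvalues_symmetric_nonempty:
  fixes M :: "real^'n^'n"
  assumes sym: "transpose M = M"
  shows "eigenvalues M \<noteq> {}"
proof -
  let ?f = "\<lambda>x. x \<bullet> (M *v x)"
  have "continuous_on (sphere 0 1) ?f"
    by (intro continuous_intros linear_continuous_on) simp
  moreover have "sphere (0::real^'n) 1 \<noteq> {}" by simp
  ultimately obtain v where v: "v \<in> sphere 0 1" and min: "\<And>x. x \<in> sphere 0 1 \<Longrightarrow> ?f v \<le> ?f x"
    using continuous_attains_inf[OF compact_sphere] by blast
  define \<mu> where "\<mu> = ?f v"
  let ?N = "M - mat \<mu>"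
  have mat: "mat c *v x = c *\<^sub>R x" for c and x :: "real^'n"
    by (simp add: vec_eq_iff matrix_vector_mult_def mat_def if_distrib if_distribR sum.delta' cong: if_cong)
  have "?N *v v = 0"
  proof (rule psd_isotropic_imp_kernel)
    show "transpose ?N = ?N"
      using sym by (simp add: transpose_def mat_def vec_eq_iff eq_commute)
    show "v \<bullet> (?N *v v) = 0"
      using v by (simp add: matrix_vector_mult_diff_rdistrib mat inner_diff_right \<mu>_def norm_eq_1)
    show "0 \<le> x \<bullet> (?N *v x)" for x
    proof (cases "x = 0")
      case False
      \<comment> \<open>The form is homogeneous of degree two, so the minimum over the sphere bounds
        it everywhere.\<close>
      have "\<mu> \<le> ?f (x /\<^sub>R norm x)"
        unfolding \<mu>_def using False by (intro min) simp
      then have "\<mu> * (norm x * norm x) \<le> ?f x"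
        using False by (simp add: matrix_vector_mult_scaleR field_simps)
      then show ?thesis
        by (simp add: matrix_vector_mult_diff_rdistrib mat inner_diff_right
            flip: power2_norm_eq_inner power2_eq_square)
    qed simp
  qed
  then have "M *v v = \<mu> *\<^sub>R v" by (simp add: matrix_vector_mult_diff_rdistrib mat)
  moreover have "v \<noteq> 0" using v by auto
  ultimately show ?thesis by (auto simp: eigenvalues_def)
qed

text \<open>\<open>Min\<close> picks an element only of a finite nonempty set, which the symmetry of
  \<open>transpose A ** A\<close> guarantees; an eigenvector for \<mu> then satisfies |A v|^2 =
  \<mu> |v|^2.\<close>

lemma sigma_min_attained:
  fixes A :: "real^'n^'n"
  obtains v where "v \<noteq> 0" "norm (A *v v) = sigma_min A * norm v"
proof -
  let ?M = "transpose A ** A"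
  have sym: "transpose ?M = ?M"
    by (simp add: matrix_transpose_mul)
  have "sigma_min A \<in> singular_values A"
    unfolding sigma_min_def
    by (rule Min_in)
      (simp_all add: singular_values_def finite_eigenvalues_symmetric[OF sym]
        eigenvalues_symmetric_nonempty[OF sym])
  then obtain \<mu> v where *: "sigma_min A = sqrt \<mu>" "v \<noteq> 0" "?M *v v = \<mu> *\<^sub>R v"
    by (auto simp: singular_values_def eigenvalues_def)
  have "(A *v v) \<bullet> (A *v v) = \<mu> * (v \<bullet> v)"
    using inner_matrix_transpose[of A v "A *v v"] * by (simp add: matrix_vector_mul_assoc)
  then have "norm (A *v v) = sigma_min A * norm v"
    by (simp add: norm_eq_sqrt_inner real_sqrt_mult *)
  with * that show ?thesis by blast
qed

text \<open>Apply the inverse to \<open>A *v v\<close> for a \<open>v\<close> attaining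
  \<open>sigma_min A\<close>, then cancel |v|. This turns an upper bound on
  \<open>sigma_min A\<close> into a lower bound on the norm of the inverse.\<close>

lemma sigma_min_mult_norm_inv_ge_1:
  fixes A :: "real^'n^'n"
  assumes "invertible A"
  shows "1 \<le> sigma_min A * spectral_norm (matrix_inv A)"
proof -
  obtain v where v: "v \<noteq> 0" "norm (A *v v) = sigma_min A * norm v"
    by (rule sigma_min_attained)
  have "norm v = norm (matrix_inv A *v (A *v v))"
    by (simp add: matrix_vector_mul_assoc matrix_inv_mult assms)
  also have "\<dots> \<le> spectral_norm (matrix_inv A) * (sigma_min A * norm v)"
    using norm_matrix_vector_le[of "matrix_inv A" "A *v v"] v by simp
  finally show ?thesis using v by (simp add: mult_ac)
qed

section \<open>The Woodbury identity and perturbation of inverses\<close>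

lemma woodbury:
  fixes A :: "real^'n^'n" and U V :: "real^'k^'n"
  defines "X \<equiv> matrix_inv A"
  defines "C \<equiv> mat 1 + transpose V ** X ** U"
  assumes A: "invertible A" and C: "invertible C"
  shows "matrix_inv (A + U ** transpose V) = X - X ** U ** matrix_inv C ** transpose V ** X"
proof (rule matrix_inv_eqI)
  let ?W = "matrix_inv C" and ?V = "transpose V"
  have AX: "A ** X = mat 1" unfolding X_def by (rule matrix_inv_mult[OF A])
  \<comment> \<open>Expanding \<open>C\<close> in C W = I, placed between U and V^T X, shows that
    the correction terms of the product below cancel.\<close>
  have "U ** (C ** ?W) ** ?V ** X = U ** ?V ** X"
    by (simp add: matrix_inv_mult[OF C])
  then have "U ** ?W ** ?V ** X + U ** ?V ** X ** U ** ?W ** ?V ** X = U ** ?V ** X"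
    by (simp add: C_def matrix_add_ldistrib matrix_add_rdistrib matrix_mul_assoc)
  then show "(A + U ** ?V) ** (X - X ** U ** ?W ** ?V ** X) = mat 1"
    by (simp add: matrix_add_rdistrib matrix_sub_ldistrib matrix_mul_assoc AX)
qed

lemma matrix_inv_diff:
  fixes C D :: "real^'k^'k"
  assumes "invertible C" "invertible D"
  shows "matrix_inv D - matrix_inv C = matrix_inv D ** (C - D) ** matrix_inv C"
proof -
  have "matrix_inv D ** (C - D) ** matrix_inv C
      = matrix_inv D ** (C ** matrix_inv C) - (matrix_inv D ** D) ** matrix_inv C"
    by (simp only: matrix_sub_ldistrib matrix_sub_rdistrib matrix_mul_assoc)
  then show ?thesis by (simp add: matrix_inv_mult assms)
qed

text \<open>The bound is self-improving: by \<open>matrix_inv_diff\<close> the difference has norm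
  at most half that of the inverse of \<open>D\<close>, so the triangle inequality yields 2
  \<alpha>, and feeding this back gives the second claim.\<close>

lemma spectral_norm_inv_perturbation:
  fixes C D :: "real^'k^'k"
  assumes inv: "invertible C" "invertible D"
    and \<alpha>: "spectral_norm (matrix_inv C) \<le> \<alpha>"
    and \<delta>: "spectral_norm (D - C) \<le> \<delta>" and small: "\<delta> * \<alpha> \<le> 1 / 2"
  shows "spectral_norm (matrix_inv D) \<le> 2 * \<alpha>"
    and "spectral_norm (matrix_inv D - matrix_inv C) \<le> 2 * \<delta> * \<alpha>\<^sup>2"
proof -
  let ?d = "spectral_norm (matrix_inv D)"
  let ?diff = "spectral_norm (matrix_inv D - matrix_inv C)"
  have \<alpha>0: "0 \<le> \<alpha>" and \<delta>0: "0 \<le> \<delta>"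
    using \<alpha> \<delta> spectral_norm_nonneg order_trans by blast+
  have "?diff \<le> ?d * spectral_norm (C - D) * spectral_norm (matrix_inv C)"
    unfolding matrix_inv_diff[OF inv]
    by (rule order_trans[OF spectral_norm_mult_le])
      (intro mult_right_mono spectral_norm_mult_le spectral_norm_nonneg)
  also have "\<dots> \<le> ?d * \<delta> * \<alpha>"
    using \<alpha> \<delta> \<alpha>0 \<delta>0
    by (intro mult_mono) (auto simp: spectral_norm_nonneg spectral_norm_minus_commute[of C])
  finally have diff: "?diff \<le> ?d * (\<delta> * \<alpha>)" by (simp add: mult.assoc)
  also have "\<dots> \<le> ?d * (1 / 2)"
    by (intro mult_left_mono small spectral_norm_nonneg)
  finally have "?diff \<le> ?d / 2" by simp
  moreover have "?d \<le> ?diff + spectral_norm (matrix_inv C)"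
    using spectral_norm_add_le[of "matrix_inv D - matrix_inv C" "matrix_inv C"] by simp
  ultimately show d: "?d \<le> 2 * \<alpha>" using \<alpha> by simp
  have "?d * (\<delta> * \<alpha>) \<le> 2 * \<alpha> * (\<delta> * \<alpha>)"
    using d \<alpha>0 \<delta>0 by (intro mult_right_mono) auto
  with diff show "?diff \<le> 2 * \<delta> * \<alpha>\<^sup>2"
    by (simp add: power2_eq_square mult_ac)
qed

section \<open>Decomposition and estimation of the error\<close>

text \<open>Common shape of the three products in the error decomposition; submultiplicativity
  bounds each of them.\<close>

lemma spectral_norm_low_rank_le:
  fixes L R :: "real^'n^'n" and U V :: "real^'k^'n" and T :: "real^'k^'k"
  assumes "spectral_norm L \<le> l" "spectral_norm T \<le> t" "spectral_norm R \<le> r"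
  shows "spectral_norm (L ** U ** T ** transpose V ** R)
    \<le> l * (spectral_norm U * spectral_norm V) * t * r"
proof -
  have nn: "0 \<le> l" "0 \<le> t" "0 \<le> r"
    using assms spectral_norm_nonneg order_trans by blast+
  note mult = order_trans[OF spectral_norm_mult_le mult_mono]
  have "spectral_norm (L ** U ** T ** transpose V ** R)
      \<le> l * spectral_norm U * t * spectral_norm V * r"
    using assms nn
    by (intro mult order_refl spectral_norm_transpose_le mult_nonneg_nonneg spectral_norm_nonneg)
  then show ?thesis by (simp add: mult_ac)
qed

text \<open>Telescoping from \<open>Y\<close>, \<open>Z\<close>, \<open>Y\<close> to
  \<open>X\<close>, \<open>W\<close>, \<open>X\<close>, one factor at a time from the left.\<close>

lemma woodbury_error_decomposition:
  fixes X Y :: "real^'n^'n" and U V :: "real^'k^'n" and W Z :: "real^'k^'k"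
  shows "(X - X ** U ** W ** transpose V ** X) - (Y - Y ** U ** Z ** transpose V ** Y)
    = (Y - X) ** U ** Z ** transpose V ** Y + X ** U ** (Z - W) ** transpose V ** Y
      + X ** U ** W ** transpose V ** (Y - X) - (Y - X)"
  by (simp add: matrix_sub_ldistrib matrix_sub_rdistrib)

text \<open>
  In the next lemma \<open>m\<close> stands for \<open>\<lambda>\<alpha>\<close>. As \<open>\<epsilon> \<le> 1/2\<close> and \<open>a, \<alpha> \<ge> 1\<close>, the factors bounding the
  approximate inverses satisfy \<open>a + \<epsilon> \<le> 3a/2\<close> and \<open>2\<alpha> + \<epsilon> \<le> 5\<alpha>/2\<close>, and \<open>m \<ge> 1\<close> then leaves the
  constant 15/4 + 9/2 + 1 + 1.
\<close>

lemma error_terms_bound: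
  fixes eps lam a \<alpha> :: real
  assumes eps: "0 \<le> eps" and lam: "0 < lam" and a: "1 \<le> a" and \<alpha>: "1 \<le> \<alpha>"
    and m: "1 \<le> lam * \<alpha>" and small: "eps * lam * \<alpha> \<le> 1 / 2"
  shows "eps * lam * (2 * \<alpha> + eps) * (a + eps)
      + a * lam * (eps + 2 * (lam * eps) * \<alpha>\<^sup>2) * (a + eps) + a * lam * \<alpha> * eps + eps
    \<le> 16 * eps * lam\<^sup>2 * a\<^sup>2 * \<alpha>\<^sup>2"
proof -
  define m where "m = lam * \<alpha>"
  have m1: "1 \<le> m" using m by (simp add: m_def)
  \<comment> \<open>Since m is at least 1, \<open>small\<close> bounds \<open>eps\<close> itself by
    1/2.\<close>
  have "eps * 1 \<le> eps * m" using eps m1 by (intro mult_left_mono)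
  then have eps2: "eps \<le> 1 / 2" using small by (simp add: m_def mult_ac)
  have lam_m: "lam \<le> m" using lam \<alpha> by (simp add: m_def)
  have mm: "m \<le> m\<^sup>2" using m1 by (simp add: power2_eq_square)
  have aa: "a \<le> a\<^sup>2" using a by (simp add: power2_eq_square)
  have Y: "a + eps \<le> 3 / 2 * a" using eps2 a by simp
  have ma: "m * a \<le> m\<^sup>2 * a\<^sup>2" using mm aa m1 a by (intro mult_mono) auto
  have one: "1 \<le> m * a" using mult_mono[OF m1 a] m1 by simp
  have "eps * lam * (2 * \<alpha> + eps) * (a + eps) \<le> eps * lam * (5 / 2 * \<alpha>) * (3 / 2 * a)"
    using Y eps eps2 lam a \<alpha> by (intro mult_mono) auto
  also have "\<dots> = eps * (15 / 4 * (m * a))" by (simp add: m_def)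
  finally have t1: "eps * lam * (2 * \<alpha> + eps) * (a + eps) \<le> eps * (15 / 4 * (m * a))" .
  \<comment> \<open>Absorbing the outer \<open>lam\<close> turns the perturbation part into a
    multiple of m^2; the leftover \<open>lam\<close> is at most m, hence at most m^2.\<close>
  have "lam * (eps + 2 * (lam * eps) * \<alpha>\<^sup>2) = eps * (lam + 2 * m\<^sup>2)"
    by (simp add: m_def power2_eq_square algebra_simps)
  also have "\<dots> \<le> eps * (3 * m\<^sup>2)"
    using lam_m mm eps by (intro mult_left_mono) auto
  finally have F: "lam * (eps + 2 * (lam * eps) * \<alpha>\<^sup>2) \<le> eps * (3 * m\<^sup>2)" .
  have "a * (lam * (eps + 2 * (lam * eps) * \<alpha>\<^sup>2)) * (a + eps) \<le> a * (eps * (3 * m\<^sup>2)) * (3 / 2 * a)"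
    using eps a by (intro mult_mono[OF mult_left_mono[OF F] Y]) auto
  also have "\<dots> = eps * (9 / 2 * (m\<^sup>2 * a\<^sup>2))" by (simp add: power2_eq_square)
  finally have t2: "a * lam * (eps + 2 * (lam * eps) * \<alpha>\<^sup>2) * (a + eps)
      \<le> eps * (9 / 2 * (m\<^sup>2 * a\<^sup>2))"
    by (simp add: mult.assoc)
  have t3: "a * lam * \<alpha> * eps = eps * (m * a)" by (simp add: m_def)
  have "eps * (15 / 4 * (m * a)) + eps * (9 / 2 * (m\<^sup>2 * a\<^sup>2)) + eps * (m * a) + eps
      = eps * (15 / 4 * (m * a) + 9 / 2 * (m\<^sup>2 * a\<^sup>2) + m * a + 1)"
    by (simp add: algebra_simps)
  \<comment> \<open>By 1 \<le> m a \<le> m^2 a^2 the coefficients add up to 41/4, below 16.\<close>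
  also have "\<dots> \<le> eps * (16 * (m\<^sup>2 * a\<^sup>2))"
    using ma one by (intro mult_left_mono eps) linarith
  also have "\<dots> = 16 * eps * lam\<^sup>2 * a\<^sup>2 * \<alpha>\<^sup>2" by (simp add: m_def power_mult_distrib)
  finally show ?thesis using t1 t2 t3 by linarith
qed

section \<open>Combination of the bounds for the approximate inverse of \<open>B\<close>\<close>

theorem mainTheorem5:
  fixes A B At :: "real^'n^'n"
    and U V :: "real^'k^'n"
    and Z :: "real^'k^'k"
    and eps1 eps2 eps lam \<alpha> :: real
  assumes "invertible A"
    and "rank U = CARD('k)"
    and "rank V = CARD('k)"
    and "invertible (mat 1 + transpose V ** matrix_inv A ** U)"
    and "B = A + U ** transpose V"
    and "invertible (mat 1 + transpose V ** At ** U)"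
    and "eps1 = spectral_norm (At - matrix_inv A)"
    and "eps2 = spectral_norm (Z - matrix_inv (mat 1 + transpose V ** At ** U))"
    and "lam = spectral_norm U * spectral_norm V"
    and "spectral_norm (matrix_inv (mat 1 + transpose V ** matrix_inv A ** U)) \<le> \<alpha>"
    and "eps1 = eps" and "eps2 = eps" and "eps \<le> 1"
    and "sigma_min A \<le> 1"
    and "eps1 < 1 / (2 * lam * \<alpha>)"
    and "\<alpha> \<ge> max (inverse lam) 1"
  shows "spectral_norm (matrix_inv B - (At - At ** U ** Z ** transpose V ** At))
         \<le> 16 * eps * lam\<^sup>2 * (spectral_norm (matrix_inv A))\<^sup>2 * \<alpha>\<^sup>2"
proof -
  let ?X = "matrix_inv A"
  let ?C = "mat 1 + transpose V ** ?X ** U" and ?D = "mat 1 + transpose V ** At ** U"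
  let ?W = "matrix_inv ?C"
  define a where "a = spectral_norm ?X"
  have eps: "spectral_norm (At - ?X) = eps" "spectral_norm (Z - matrix_inv ?D) = eps"
    using assms(7,8,11,12) by simp_all
  have eps0: "0 \<le> eps" using spectral_norm_nonneg[of "At - ?X"] eps by simp
  have \<alpha>: "1 \<le> \<alpha>" "inverse lam \<le> \<alpha>" using assms(16) by auto
  have lam_nonneg: "0 \<le> lam" by (simp add: assms(9) spectral_norm_nonneg)
  \<comment> \<open>Since \<open>1 / 0 = 0\<close>, the strict bound on \<open>eps1\<close> excludes \<open>lam = 0\<close>.\<close>
  have "lam \<noteq> 0" using assms(11,15) eps0 by auto
  with lam_nonneg have lam: "0 < lam" by simp
  have m: "1 \<le> lam * \<alpha>" using \<alpha> lam by (simp add: field_simps)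
  have small: "eps * lam * \<alpha> \<le> 1 / 2"
    using assms(11,15) lam \<alpha> by (simp add: field_simps)
  have a: "1 \<le> a"
  proof -
    have "1 \<le> sigma_min A * a"
      unfolding a_def by (rule sigma_min_mult_norm_inv_ge_1[OF assms(1)])
    also have "\<dots> \<le> 1 * a"
      by (intro mult_right_mono assms(14)) (simp add: a_def spectral_norm_nonneg)
    finally show ?thesis by simp
  qed

  \<comment> \<open>The identity matrices cancel, so the capacitance matrices differ by at most
    \<open>lam * eps\<close>.\<close>
  have "?D - ?C = transpose V ** (At - ?X) ** U"
    by (simp add: matrix_sub_ldistrib matrix_sub_rdistrib)
  also have "spectral_norm \<dots> \<le> spectral_norm (transpose V) * spectral_norm (At - ?X) * spectral_norm U"
    by (rule order_trans[OF spectral_norm_mult_le])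
      (intro mult_right_mono spectral_norm_mult_le spectral_norm_nonneg)
  also have "\<dots> \<le> spectral_norm V * eps * spectral_norm U"
    unfolding eps
    by (intro mult_right_mono spectral_norm_transpose_le eps0 spectral_norm_nonneg)
  finally have D: "spectral_norm (?D - ?C) \<le> lam * eps"
    by (simp add: assms(9) mult_ac)
  have small': "lam * eps * \<alpha> \<le> 1 / 2" using small by (simp add: mult_ac)
  note pert = spectral_norm_inv_perturbation[OF assms(4,6,10) D small']

  have Y: "spectral_norm At \<le> a + eps"
    using spectral_norm_add_le[of ?X "At - ?X"] eps by (simp add: a_def)
  have Z: "spectral_norm Z \<le> 2 * \<alpha> + eps"
    using spectral_norm_add_le[of "matrix_inv ?D" "Z - matrix_inv ?D"] eps pert(1) by simp
  \<comment> \<open>\<open>Z\<close> approximates the inverse of \<open>?D\<close> rather than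
    \<open>?W\<close>, so its own error \<open>eps\<close> and the perturbation of the inverse add
    up.\<close>
  have F: "spectral_norm (Z - ?W) \<le> eps + 2 * (lam * eps) * \<alpha>\<^sup>2"
    using spectral_norm_add_le[of "Z - matrix_inv ?D" "matrix_inv ?D - ?W"] eps pert(2) by simp

  let ?T1 = "(At - ?X) ** U ** Z ** transpose V ** At"
  let ?T2 = "?X ** U ** (Z - ?W) ** transpose V ** At"
  let ?T3 = "?X ** U ** ?W ** transpose V ** (At - ?X)"
  have decomp: "matrix_inv B - (At - At ** U ** Z ** transpose V ** At) = ?T1 + ?T2 + ?T3 - (At - ?X)"
    unfolding assms(5) woodbury[OF assms(1,4)] by (rule woodbury_error_decomposition)
  have "spectral_norm (matrix_inv B - (At - At ** U ** Z ** transpose V ** At))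
      \<le> spectral_norm ?T1 + spectral_norm ?T2 + spectral_norm ?T3 + eps"
    unfolding decomp using spectral_norm_diff_le[of "?T1 + ?T2 + ?T3" "At - ?X"]
      spectral_norm_add_le[of "?T1 + ?T2" ?T3] spectral_norm_add_le[of ?T1 ?T2] eps(1)
    by linarith
  also have "\<dots> \<le> eps * lam * (2 * \<alpha> + eps) * (a + eps)
      + a * lam * (eps + 2 * (lam * eps) * \<alpha>\<^sup>2) * (a + eps) + a * lam * \<alpha> * eps + eps"
    unfolding assms(9)
    by (intro add_mono order_refl spectral_norm_low_rank_le Y Z F[unfolded assms(9)] assms(10))
      (simp_all add: eps a_def)
  also have "\<dots> \<le> 16 * eps * lam\<^sup>2 * a\<^sup>2 * \<alpha>\<^sup>2"
    by (rule error_terms_bound[OF eps0 lam a \<alpha>(1) m small])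
  finally show ?thesis by (simp only: a_def)
qed

end
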